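(* Given a convex polygon $P\subset\mathbf{R}^2$, there exists a constant $C$ such that for all non-negative continuous convex functions $f$ on $P$, $$\Vert f\Vert_{L^2(P)}\le C\int_{\partial P}f\,d\sigma .$$
   Context: $P$ is a compact convex polygon with non-empty interior, defined by finitely many inequalities $h_k(x)\ge c_k$ with $h_k:\mathbf{R}^2\to\mathbf{R}$ linear and inducing primitive maps $\mathbf{Z}^2\to\mathbf{Z}$. $d\mu$ is Lebesgue measure on $P$ (used for $L^2(P)$), and $d\sigma$ is the measure on $\partial P$ which on the edge $h_r=c_r$ is the constant 1-form with $dh_r\wedge d\sigma=\pm d\mu$ (so on each edge it is a positive constant multiple of arc length). *)

theory Defs
  imports "HOL-Analysis.Analysis"
begin

text \<open>A primitive map on the lattice of integer points is a linear functional with coprime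
  integer coefficients.\<close>

definition primitive_map :: "(real^2 \<Rightarrow> real) \<Rightarrow> bool" where
  "primitive_map h \<longleftrightarrow> linear h \<and>
     (\<exists>a b :: int. coprime a b \<and> (\<forall>x. h x = of_int a * x$1 + of_int b * x$2))"

text \<open>The inequalities \<open>h x \<ge> c\<close> form a set \<open>H\<close> of pairs \<open>(h, c)\<close> rather than an indexed family,
  so none is listed twice. As the \<open>h\<close> are primitive, distinct pairs then define distinct lines or
  opposite half-planes of one line, and the latter is excluded by the non-empty interior. Redundant
  inequalities are allowed.\<close>

definition polygon :: "(real^2) set \<Rightarrow> ((real^2 \<Rightarrow> real) \<times> real) set \<Rightarrow> bool" where
  "polygon P H \<longleftrightarrow>
     finite H \<and> (\<forall>(h, c)\<in>H. primitive_map h) \<and>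
     P = {x. \<forall>(h, c)\<in>H. h x \<ge> c} \<and> compact P \<and> interior P \<noteq> {}"

text \<open>Constant 1-forms on the plane are linear functionals, constant 2-forms are functions of two
  vectors.\<close>

definition wedge :: "(real^2 \<Rightarrow> real) \<Rightarrow> (real^2 \<Rightarrow> real) \<Rightarrow> real^2 \<Rightarrow> real^2 \<Rightarrow> real" where
  "wedge \<alpha> \<beta> u v = \<alpha> u * \<beta> v - \<alpha> v * \<beta> u"

definition area_form :: "real^2 \<Rightarrow> real^2 \<Rightarrow> real" where
  "area_form u v = u$1 * v$2 - u$2 * v$1"

text \<open>As \<open>h\<close> is linear, \<open>dh = h\<close>.\<close>

definition is_edge_form :: "(real^2 \<Rightarrow> real) \<Rightarrow> (real^2 \<Rightarrow> real) \<Rightarrow> bool" where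
  "is_edge_form h s \<longleftrightarrow> linear s \<and>
     ((\<forall>u v. wedge h s u v = area_form u v) \<or> (\<forall>u v. wedge h s u v = - area_form u v))"

definition edge_form :: "(real^2 \<Rightarrow> real) \<Rightarrow> real^2 \<Rightarrow> real" where
  "edge_form h = (SOME s. is_edge_form h s)"

definition edge :: "(real^2) set \<Rightarrow> (real^2 \<Rightarrow> real) \<Rightarrow> real \<Rightarrow> (real^2) set" where
  "edge P h c = P \<inter> {x. h x = c}"

text \<open>An edge form is an affine coordinate on the line \<open>h = c\<close>, so the measure that it defines
  there is the pullback of Lebesgue measure on the reals along this coordinate. An inequality
  whose line meets \<open>P\<close> in at most one point contributes zero.\<close>

definition boundary_measure ::
    "(real^2) set \<Rightarrow> ((real^2 \<Rightarrow> real) \<times> real) set \<Rightarrow> (real^2) measure" where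
  "boundary_measure P H = measure_of UNIV (sets borel)
     (\<lambda>A. \<Sum>(h, c)\<in>H. emeasure lborel (edge_form h ` (A \<inter> edge P h c)))"

definition L2_norm :: "(real^2) set \<Rightarrow> (real^2 \<Rightarrow> real) \<Rightarrow> real" where
  "L2_norm P f = sqrt (LINT x:P|lborel. \<bar>f x\<bar>\<^sup>2)"


lemma linear_coords:
  fixes h :: "real^2 \<Rightarrow> real"
  assumes "linear h"
  shows "h x = h (axis 1 1) * x$1 + h (axis 2 1) * x$2"
proof -
  have "x = x$1 *\<^sub>R axis 1 1 + x$2 *\<^sub>R axis 2 1"
    by (simp add: vec_eq_iff forall_2 axis_def)
  then have "h x = h (x$1 *\<^sub>R axis 1 1 + x$2 *\<^sub>R axis 2 1)"
    by simp
  also have "\<dots> = h (axis 1 1) * x$1 + h (axis 2 1) * x$2"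
    using assms by (simp add: linear_add linear_scale mult.commute)
  finally show ?thesis .
qed

lemma is_edge_form_exists:
  assumes "primitive_map h"
  shows "\<exists>s. is_edge_form h s"
proof -
  obtain a b :: int where ab: "coprime a b" and h: "\<And>x. h x = of_int a * x$1 + of_int b * x$2"
    using assms unfolding primitive_map_def by blast
  obtain p q :: int where "p * a + q * b = 1"
    using bezout_int[of a b] ab by (auto simp: coprime_iff_gcd_eq_1)
  then have pq: "real_of_int p * a + real_of_int q * b = 1"
    by (metis of_int_1 of_int_add of_int_mult)
  define s :: "real^2 \<Rightarrow> real" where "s = (\<lambda>x. of_int p * x$2 - of_int q * x$1)"
  have "linear s"
    unfolding s_def by (auto intro!: linearI simp: algebra_simps)
  moreover have "wedge h s u v = area_form u v" for u v
  proof -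
    have "wedge h s u v = (p * a + q * b) * area_form u v"
      unfolding wedge_def area_form_def s_def h by (simp add: algebra_simps)
    with pq show ?thesis by simp
  qed
  ultimately show ?thesis
    unfolding is_edge_form_def by blast
qed

lemma edge_form: "primitive_map h \<Longrightarrow> is_edge_form h (edge_form h)"
  unfolding edge_form_def by (rule someI_ex[OF is_edge_form_exists])

lemma image_eq_vimage_inverse:
  assumes "\<And>t. s (g t) = t" "\<And>x. x \<in> A \<Longrightarrow> g (s x) = x"
  shows "s ` A = g -` A"
proof (intro set_eqI iffI)
  fix t assume "t \<in> s ` A"
  then show "t \<in> g -` A" using assms(2) by auto
next
  fix t assume "t \<in> g -` A"
  then have "s (g t) \<in> s ` A" by blast
  then show "t \<in> s ` A" by (simp add: assms(1))
qed

lemma is_edge_form_sign: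
  assumes "is_edge_form h s"
  obtains e :: real where "e = 1 \<or> e = -1" "\<And>u v. wedge h s u v = e * area_form u v"
proof -
  have "(\<forall>u v. wedge h s u v = 1 * area_form u v) \<or> (\<forall>u v. wedge h s u v = -1 * area_form u v)"
    using assms by (simp add: is_edge_form_def)
  then show ?thesis using that[of 1] that[of "-1"] by blast
qed

lemma is_edge_form_inverse:
  assumes "linear h" "is_edge_form h s"
  obtains g :: "real \<Rightarrow> real^2"
  where "g \<in> borel_measurable borel" "\<And>t. h (g t) = c" "\<And>t. s (g t) = t"
    "\<And>x. h x = c \<Longrightarrow> g (s x) = x"
proof -
  define a b p q where abpq: "a = h (axis 1 1)" "b = h (axis 2 1)" "p = s (axis 1 1)" "q = s (axis 2 1)"
  have s: "linear s" using assms(2) by (simp add: is_edge_form_def)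
  have h_eq: "h x = a * x$1 + b * x$2" and s_eq: "s x = p * x$1 + q * x$2" for x
    unfolding abpq by (rule linear_coords[OF assms(1)], rule linear_coords[OF s])
  obtain e :: real where "e = 1 \<or> e = -1" and w: "\<And>u v. wedge h s u v = e * area_form u v"
    using is_edge_form_sign[OF assms(2)] by blast
  then have ee: "e * e = 1" by auto
  have det: "a * q - b * p = e"
    using w[of "axis 1 1" "axis 2 1"] by (simp add: wedge_def area_form_def abpq axis_def)
  define g :: "real \<Rightarrow> real^2"
    where "g = (\<lambda>t. e *\<^sub>R (q * c - b * t) *\<^sub>R axis 1 1 + e *\<^sub>R (a * t - p * c) *\<^sub>R axis 2 1)"
  have g1: "g t $ 1 = e * (q * c - b * t)" and g2: "g t $ 2 = e * (a * t - p * c)" for t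
    by (simp_all add: g_def axis_def)
  show ?thesis
  proof
    show "g \<in> borel_measurable borel"
      unfolding g_def by (intro borel_measurable_continuous_onI continuous_intros)
    show "h (g t) = c" for t
    proof -
      have "h (g t) = e * (a * q - b * p) * c"
        unfolding h_eq g1 g2 by (simp add: algebra_simps)
      then show ?thesis using det ee by simp
    qed
    show "s (g t) = t" for t
    proof -
      have "s (g t) = e * (a * q - b * p) * t"
        unfolding s_eq g1 g2 by (simp add: algebra_simps)
      then show ?thesis using det ee by simp
    qed
    show "g (s x) = x" if "h x = c" for x
    proof -
      have "g (s x) $ 1 = e * (a * q - b * p) * x$1" "g (s x) $ 2 = e * (a * q - b * p) * x$2"
        unfolding g1 g2 that[symmetric] h_eq s_eq by (simp_all add: algebra_simps)
      then show ?thesis using det ee by (simp add: vec_eq_iff forall_2)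
    qed
  qed
qed

lemma emeasure_edge_form_indep:
  assumes "primitive_map h" and s: "is_edge_form h s" and s': "is_edge_form h s'"
    and A: "A \<subseteq> {x. h x = c}" "A \<in> sets borel"
  shows "emeasure lborel (s ` A) = emeasure lborel (s' ` A)"
proof -
  have h: "linear h" using assms(1) by (simp add: primitive_map_def)
  have lin: "linear s" "linear s'" using s s' by (simp_all add: is_edge_form_def)
  obtain g where g: "g \<in> borel_measurable borel" "\<And>t. h (g t) = c" "\<And>t. s (g t) = t"
    "\<And>x. h x = c \<Longrightarrow> g (s x) = x"
    using is_edge_form_inverse[OF h s] by blast
  obtain e :: real where e: "e = 1 \<or> e = -1" and we: "\<And>u v. wedge h s u v = e * area_form u v"
    using is_edge_form_sign[OF s] by blast
  obtain e' :: real where e': "e' = 1 \<or> e' = -1" and we': "\<And>u v. wedge h s' u v = e' * area_form u v"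
    using is_edge_form_sign[OF s'] by blast
  define k where "k = e * e'"
  have "k = 1 \<or> k = -1" and w: "\<And>u v. wedge h s' u v = k * wedge h s u v"
    using e e' by (auto simp: k_def we we')
  define d where "d = s' (g 0)"
  obtain u where u: "h u \<noteq> 0"
  proof -
    have "\<exists>u. h u \<noteq> 0"
    proof (rule ccontr)
      assume "\<not> ?thesis"
      then have "wedge h s u v = 0" for u v by (simp add: wedge_def)
      then have "area_form u v = 0" for u v
        using we e by auto
      from this[of "axis 1 1" "axis 2 1"] show False by (simp add: area_form_def axis_def)
    qed
    then show ?thesis using that by blast
  qed
  have eq: "s' x = k * s x + d" if "x \<in> A" for x
  proof -
    have hx: "h (x - g 0) = 0" using that A(1) g(2) linear_diff[OF h] by auto
    then have "h u * s' (x - g 0) = h u * (k * s (x - g 0))"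
      using w[of u "x - g 0"] by (simp add: wedge_def)
    then have "s' (x - g 0) = k * s (x - g 0)" using u by simp
    then show ?thesis using g(3)[of 0] by (simp add: linear_diff[OF lin(1)] linear_diff[OF lin(2)] d_def)
  qed
  have "s' ` A = (\<lambda>t. d + k * t) ` s ` A"
    using eq by (force simp: image_image intro!: image_cong)
  also have "(\<lambda>t. d + k * t) ` s ` A = (+) d ` (*\<^sub>R) k ` s ` A"
    by (auto simp: image_image)
  also have "emeasure lebesgue \<dots> = ennreal \<bar>k\<bar> * emeasure lebesgue (s ` A)"
    using emeasure_lebesgue_affine[of k d "s ` A"] by (simp add: image_image add.commute)
  finally have leb: "emeasure lebesgue (s' ` A) = emeasure lebesgue (s ` A)"
    using \<open>k = 1 \<or> k = -1\<close> by auto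
  have img: "r ` A \<in> sets borel" if r: "is_edge_form h r" for r
  proof -
    obtain g where g: "g \<in> borel_measurable borel" "\<And>t. h (g t) = c" "\<And>t. r (g t) = t"
      "\<And>x. h x = c \<Longrightarrow> g (r x) = x"
      using is_edge_form_inverse[OF h r] by blast
    have "r ` A = g -` A"
      by (rule image_eq_vimage_inverse) (use g A(1) in auto)
    then show ?thesis using measurable_sets[OF g(1) A(2)] by simp
  qed
  show ?thesis using leb img[OF s] img[OF s'] by simp
qed

lemma sets_boundary_measure [simp, measurable_cong]: "sets (boundary_measure P H) = sets borel"
  and space_boundary_measure [simp]: "space (boundary_measure P H) = UNIV"
  unfolding boundary_measure_def
  using sets.sigma_sets_eq[of "borel :: (real^2) measure"] by (simp_all add: sets_measure_of_conv space_measure_of_conv)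

lemma emeasure_boundary_measure:
  assumes "polygon P H" and "A \<in> sets borel"
  shows "emeasure (boundary_measure P H) A =
    (\<Sum>(h, c)\<in>H. emeasure lborel (edge_form h ` (A \<inter> edge P h c)))"
proof -
  let ?m = "\<lambda>h c A. emeasure lborel (edge_form h ` (A \<inter> edge P h c))"
  have ex: "\<exists>M. sets M = sets borel \<and> (\<forall>A\<in>sets borel. emeasure M A = ?m h c A)"
    if hc: "(h, c) \<in> H" for h c
  proof -
    have prim: "primitive_map h" and P: "compact P" using assms hc by (auto simp: polygon_def)
    then have h: "linear h" by (simp add: primitive_map_def)
    obtain g where g: "g \<in> borel_measurable borel" "\<And>t. h (g t) = c"
      "\<And>t. edge_form h (g t) = t" "\<And>x. h x = c \<Longrightarrow> g (edge_form h x) = x"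
      using is_edge_form_inverse[OF h edge_form[OF prim]] by blast
    have E: "edge P h c \<in> sets borel"
    proof -
      have "closed {x. h x = c}"
        using linear_continuous_on[of h UNIV] h
        by (intro closed_Collect_eq) (auto simp: linear_conv_bounded_linear)
      then show ?thesis unfolding edge_def
        by (intro borel_closed closed_Int compact_imp_closed[OF P])
    qed
    have im: "edge_form h ` (A \<inter> edge P h c) = g -` (A \<inter> edge P h c)" for A
      by (rule image_eq_vimage_inverse) (auto simp: g edge_def)
    define M where "M = density (distr lborel borel g) (indicator (edge P h c))"
    have "emeasure M A = ?m h c A" if "A \<in> sets borel" for A
    proof -
      have "emeasure M A = emeasure (distr lborel borel g) (A \<inter> edge P h c)"
        unfolding M_def using that E by (subst emeasure_restricted) (simp_all add: Int_commute)
      also have "\<dots> = ?m h c A"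
        using that E g(1) by (subst emeasure_distr) (simp_all add: im)
      finally show ?thesis .
    qed
    then show ?thesis by (intro exI[of _ M]) (simp add: M_def)
  qed
  define M where "M = (\<lambda>e. SOME M. sets M = sets borel \<and>
    (\<forall>A\<in>sets borel. emeasure M A = ?m (fst e) (snd e) A))"
  have M': "sets (M e) = sets borel \<and> (\<forall>A\<in>sets borel. emeasure (M e) A = ?m (fst e) (snd e) A)"
    if "e \<in> H" for e
    unfolding M_def by (rule someI_ex, rule ex) (simp add: that)
  then have M: "\<And>e. e \<in> H \<Longrightarrow> sets (M e) = sets borel"
    "\<And>e A. e \<in> H \<Longrightarrow> A \<in> sets borel \<Longrightarrow> emeasure (M e) A = ?m (fst e) (snd e) A"
    by auto
  have "countably_additive (sets borel) (\<lambda>A. \<Sum>(h, c)\<in>H. ?m h c A)"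
  proof (rule countably_additiveI)
    fix F :: "nat \<Rightarrow> (real^2) set"
    assume F: "range F \<subseteq> sets borel" "disjoint_family F" "\<Union> (range F) \<in> sets borel"
    have "(\<Sum>i. \<Sum>(h, c)\<in>H. ?m h c (F i)) = (\<Sum>i. \<Sum>e\<in>H. emeasure (M e) (F i))"
      using F M(2) by (intro suminf_cong sum.cong) (auto simp: case_prod_beta)
    also have "\<dots> = (\<Sum>e\<in>H. \<Sum>i. emeasure (M e) (F i))"
      by (rule suminf_sum) simp
    also have "\<dots> = (\<Sum>e\<in>H. emeasure (M e) (\<Union> (range F)))"
      using F M(1) by (intro sum.cong refl suminf_emeasure) auto
    also have "\<dots> = (\<Sum>(h, c)\<in>H. ?m h c (\<Union> (range F)))"
      using F M(2) by (intro sum.cong) (auto simp: case_prod_beta)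
    finally show "(\<Sum>i. \<Sum>(h, c)\<in>H. ?m h c (F i)) = (\<Sum>(h, c)\<in>H. ?m h c (\<Union> (range F)))" .
  qed
  moreover have "positive (sets borel) (\<lambda>A. \<Sum>(h, c)\<in>H. ?m h c A)"
    by (auto simp: positive_def)
  ultimately show ?thesis
    using assms(2) sets.sigma_algebra_axioms[of "borel :: (real^2) measure"]
    unfolding boundary_measure_def
    by (intro emeasure_measure_of_sigma) auto
qed

end

theory Submission
  imports Defs
begin

text \<open>By convexity, \<open>f x\<close> is at most the larger of the values of \<open>f\<close> at the two ends of the
  horizontal chord of \<open>P\<close> through \<open>x\<close>, which is bounded by a function \<open>u\<close> of \<open>x$2\<close> alone; the
  vertical chord likewise gives a bound by a function \<open>v\<close> of \<open>x$1\<close>. Hence \<open>(f x)\<^sup>2 \<le> u (x$2) * v (x$1)\<close>,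
  and Fubini bounds the integral of \<open>f\<^sup>2\<close> by the product of the integrals of \<open>u\<close> and \<open>v\<close>. Each of
  these is at most a multiple of the boundary integral of \<open>f\<close>, since a coordinate projection
  scales the measure of an edge by a constant.\<close>

section \<open>Lines parametrised by a coordinate\<close>

text \<open>For linear \<open>h\<close>, \<open>i \<noteq> j\<close> and
  \<open>h (axis i 1) \<noteq> 0\<close>, this is the point where the line \<open>h x = c\<close>
  meets the line \<open>x$j = y\<close>. If \<open>h (axis i 1) = 0\<close>, division by zero makes
  the value meaningless; such lines, parallel to the chords in direction \<open>i\<close>, are left
  out of the sums below.\<close>

definition line_point :: "(real^2 \<Rightarrow> real) \<Rightarrow> real \<Rightarrow> 2 \<Rightarrow> 2 \<Rightarrow> real \<Rightarrow> real^2" where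
  "line_point h c i j y = y *\<^sub>R axis j 1 + ((c - y * h (axis j 1)) / h (axis i 1)) *\<^sub>R axis i 1"

lemma linear_coords_distinct:
  fixes h :: "real^2 \<Rightarrow> real"
  assumes "linear h" "i \<noteq> j"
  shows "h x = h (axis i 1) * x$i + h (axis j 1) * x$j"
  using exhaust_2[of i] exhaust_2[of j] assms(2) linear_coords[OF assms(1), of x] by auto

lemma line_point_on_line:
  assumes "linear h" "h (axis i 1) \<noteq> 0"
  shows "h (line_point h c i j y) = c"
  using assms(2) by (simp add: line_point_def linear_add[OF assms(1)] linear_scale[OF assms(1)])

lemma line_point_unique:
  assumes "linear h" "i \<noteq> j" "h (axis i 1) \<noteq> 0" "h x = c"
  shows "line_point h c i j (x$j) = x"
proof -
  have xi: "x$i = (c - x$j * h (axis j 1)) / h (axis i 1)"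
    using linear_coords_distinct[OF assms(1,2), of x] assms(3,4) by (simp add: field_simps)
  have ij: "k = i \<or> k = j" for k
    using exhaust_2[of i] exhaust_2[of j] exhaust_2[of k] assms(2) by auto
  have "line_point h c i j (x$j) $ k = x $ k" for k
    using ij[of k] assms(2) xi by (auto simp: line_point_def axis_def)
  then show ?thesis by (simp add: vec_eq_iff)
qed

lemma line_point_measurable [measurable]: "line_point h c i j \<in> borel_measurable borel"
  unfolding line_point_def[abs_def] divide_inverse
  by (intro borel_measurable_continuous_onI continuous_intros)

section \<open>Edges, frontier and rays\<close>

lemma primitive_map_nonzero:
  assumes "primitive_map h"
  obtains v where "h v \<noteq> 0"
proof -
  obtain s where "is_edge_form h s"
    using is_edge_form_exists[OF assms] by blast
  then have "wedge h s (axis 1 1) (axis 2 1) \<noteq> 0"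
    by (auto simp: is_edge_form_def area_form_def axis_def)
  then have "h (axis 1 1) \<noteq> 0 \<or> h (axis 2 1) \<noteq> 0"
    by (auto simp: wedge_def)
  then show ?thesis using that by blast
qed

text \<open>At a point with \<open>h x = c\<close>, an arbitrarily small step in a direction where
  \<open>h\<close> decreases leaves \<open>P\<close>.\<close>

lemma edge_subset_frontier:
  assumes "polygon P H" "(h, c) \<in> H"
  shows "edge P h c \<subseteq> frontier P"
proof
  fix x assume x: "x \<in> edge P h c"
  have prim: "primitive_map h" and "compact P" using assms by (auto simp: polygon_def)
  then have h: "linear h" by (simp add: primitive_map_def)
  obtain v where v: "h v \<noteq> 0" using primitive_map_nonzero[OF prim] .
  have "x \<notin> interior P"
  proof
    assume "x \<in> interior P"
    then obtain e where e: "e > 0" "cball x e \<subseteq> P" by (auto simp: mem_interior_cball)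
    have v0: "v \<noteq> 0" using v linear_0[OF h] by auto
    \<comment> \<open>This step has length \<open>e\<close>, so it stays in the ball, and its sign
      makes \<open>h w\<close> negative.\<close>
    define w where "w = - (e * sgn (h v) / norm v) *\<^sub>R v"
    have "norm w \<le> e" using v0 v e(1) by (simp add: w_def abs_mult sgn_real_def)
    then have "x + w \<in> P" using e(2) by (auto simp: dist_norm)
    then have "h (x + w) \<ge> c" using assms by (auto simp: polygon_def)
    moreover have "h x = c" using x by (simp add: edge_def)
    ultimately have "h w \<ge> 0" using linear_add[OF h] by simp
    moreover have "h w = - (e / norm v) * \<bar>h v\<bar>"
      unfolding w_def linear_scale[OF h] by (simp add: sgn_real_def)
    moreover have "e / norm v * \<bar>h v\<bar> > 0" using v v0 e(1) by simp
    ultimately show False by linarith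
  qed
  then show "x \<in> frontier P"
    using x \<open>compact P\<close> by (simp add: edge_def frontier_def compact_imp_closed)
qed

text \<open>As \<open>P\<close> is bounded, the ray must leave it, and the first inequality to fail
  is tight at the exit point. That \<open>h w \<noteq> 0\<close> makes the edge transversal to the
  ray, as \<open>line_point\<close> requires.\<close>

lemma polygon_ray_meets_edge:
  assumes poly: "polygon P H" and "x \<in> P" "w \<noteq> 0"
  obtains t h c where "t \<ge> 0" "(h, c) \<in> H" "h w \<noteq> 0" "x + t *\<^sub>R w \<in> edge P h c"
proof -
  have fin: "finite H" and "compact P"
    and P: "\<And>y. y \<in> P \<longleftrightarrow> (\<forall>(h, c)\<in>H. h y \<ge> c)"
    and lin: "\<And>h c. (h, c) \<in> H \<Longrightarrow> linear h"
    using poly by (auto simp: polygon_def primitive_map_def)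
  have hw: "h (x + t *\<^sub>R w) = h x + t * h w" if "(h, c) \<in> H" for h c t
    using lin[OF that] by (simp add: linear_add linear_scale)
  \<comment> \<open>Only inequalities whose left side decreases along \<open>w\<close> can fail on
    the ray.\<close>
  define K where "K = {(h, c) \<in> H. h w < 0}"
  have "finite K" using fin by (auto simp: K_def intro: finite_subset)
  have "K \<noteq> {}"
  proof
    assume "K = {}"
    then have ray: "x + t *\<^sub>R w \<in> P" if "t \<ge> 0" for t
      using \<open>x \<in> P\<close> that unfolding P by (force simp: K_def hw intro: add_increasing2)
    obtain B where B: "\<And>y. y \<in> P \<Longrightarrow> norm y \<le> B"
      using compact_imp_bounded[OF \<open>compact P\<close>] by (auto simp: bounded_iff)
    have "B \<ge> 0" using B[OF \<open>x \<in> P\<close>] norm_ge_zero order_trans by blast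
    \<comment> \<open>At this time the displacement is so long that the point has norm at least
      \<open>B + 1\<close>.\<close>
    define t where "t = (B + norm x + 1) / norm w"
    have "t \<ge> 0" using \<open>B \<ge> 0\<close> by (simp add: t_def)
    then have "norm (x + t *\<^sub>R w) \<le> B" using B ray by blast
    moreover have "norm (t *\<^sub>R w) = B + norm x + 1"
      using \<open>w \<noteq> 0\<close> \<open>B \<ge> 0\<close> by (simp add: t_def abs_of_nonneg)
    ultimately show False
      using norm_triangle_ineq2[of "t *\<^sub>R w" "- x"] by (simp add: add.commute)
  qed
  \<comment> \<open>The time at which the ray reaches the line of the inequality; the least one over
    \<open>K\<close> is the exit time.\<close>
  define r :: "((real^2 \<Rightarrow> real) \<times> real) \<Rightarrow> real"
    where "r = (\<lambda>(h, c). (h x - c) / (- h w))"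
  obtain h c where hc: "(h, c) \<in> K" and min: "\<And>k. k \<in> K \<Longrightarrow> r (h, c) \<le> r k"
    using arg_min_if_finite[OF \<open>finite K\<close> \<open>K \<noteq> {}\<close>, of r] by (metis surj_pair linorder_not_less)
  then have H: "(h, c) \<in> H" and neg: "h w < 0" by (auto simp: K_def)
  define t where "t = r (h, c)"
  have "t \<ge> 0" using \<open>x \<in> P\<close> H neg unfolding P by (auto simp: t_def r_def divide_nonneg_neg)
  have "x + t *\<^sub>R w \<in> P"
    unfolding P
  proof safe
    fix h' c' assume H': "(h', c') \<in> H"
    then have ge: "h' x \<ge> c'" using \<open>x \<in> P\<close> by (auto simp: P)
    show "h' (x + t *\<^sub>R w) \<ge> c'"
    proof (cases "h' w < 0")
      case True
      then have "t \<le> (h' x - c') / (- h' w)"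
        using min[of "(h', c')"] H' by (auto simp: K_def t_def r_def)
      then have "t * (- h' w) \<le> h' x - c'" using True by (simp add: field_simps)
      then show ?thesis by (simp add: hw[OF H'])
    next
      case False
      then have "t * h' w \<ge> 0" using \<open>t \<ge> 0\<close> by simp
      with ge show ?thesis by (simp add: hw[OF H'])
    qed
  qed
  moreover have "h (x + t *\<^sub>R w) = c"
    unfolding hw[OF H] using neg by (simp add: t_def r_def)
  ultimately show ?thesis using that[OF \<open>t \<ge> 0\<close> H] neg by (simp add: edge_def)
qed

section \<open>Convexity along chords\<close>

lemma convex_on_le_max_ends:
  fixes x w :: "'a::real_vector"
  assumes "convex_on S f" "x + s *\<^sub>R w \<in> S" "x + t *\<^sub>R (- w) \<in> S" "s \<ge> 0" "t \<ge> 0"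
  shows "f x \<le> max (f (x + s *\<^sub>R w)) (f (x + t *\<^sub>R (- w)))"
proof (cases "s + t = 0")
  case True
  then have "s = 0" "t = 0" using assms(4,5) by linarith+
  then show ?thesis by simp
next
  case False
  let ?a = "x + s *\<^sub>R w" and ?b = "x + t *\<^sub>R (- w)"
  \<comment> \<open>Each end is weighted by the distance of the other, so that the displacements
    along \<open>w\<close> cancel.\<close>
  define u v where "u = t / (s + t)" and "v = s / (s + t)"
  have uv: "u \<ge> 0" "v \<ge> 0" "u + v = 1"
    using False assms(4,5) by (auto simp: u_def v_def add_divide_distrib[symmetric])
  have "u * s = v * t" by (simp add: u_def v_def)
  have "u *\<^sub>R ?a + v *\<^sub>R ?b = (u + v) *\<^sub>R x + (u * s - v * t) *\<^sub>R w"
    by (simp add: algebra_simps)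
  then have "u *\<^sub>R ?a + v *\<^sub>R ?b = x" using uv \<open>u * s = v * t\<close> by simp
  then have "f x \<le> u * f ?a + v * f ?b"
    using convex_lower convex_on_def assms uv by metis
  also have "\<dots> \<le> max (f ?a) (f ?b)"
    using uv by (intro convex_bound_le) auto
  finally show ?thesis .
qed

text \<open>Both ends of the chord through \<open>x\<close> in direction \<open>i\<close> are
  frontier points on lines transversal to it. Which lines are hit depends on \<open>x\<close>, so
  the bound sums over all of them; the indicator discards points off the frontier, and the terms are
  non-negative. The bound depends on \<open>x\<close> only through \<open>x$j\<close>.\<close>

lemma convex_le_sum_line_points:
  assumes poly: "polygon P H" and conv: "convex_on P f" and nn: "\<And>x. x \<in> P \<Longrightarrow> 0 \<le> f x"
    and "x \<in> P" "i \<noteq> j"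
  shows "f x \<le> (\<Sum>(h, c) \<in> {(h, c) \<in> H. h (axis i 1) \<noteq> 0}.
    indicator (frontier P) (line_point h c i j (x$j)) * f (line_point h c i j (x$j)))"
    (is "f x \<le> (\<Sum>(h, c) \<in> ?K. ?F h c)")
proof -
  have "finite H" and "compact P" and lin: "\<And>h c. (h, c) \<in> H \<Longrightarrow> linear h"
    using poly by (auto simp: polygon_def primitive_map_def)
  have fK: "finite ?K" by (rule finite_subset[OF _ \<open>finite H\<close>]) auto
  have F0: "?F h c \<ge> 0" for h c
    using nn \<open>compact P\<close> frontier_subset_compact by (fastforce simp: indicator_def)
  have end_le: "\<exists>t\<ge>0. x + t *\<^sub>R w \<in> P \<and> f (x + t *\<^sub>R w) \<le> (\<Sum>(h, c) \<in> ?K. ?F h c)"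
    if w: "w = axis i 1 \<or> w = - axis i 1" for w
  proof -
    have "w \<noteq> 0" using w by (auto simp: axis_eq_0_iff)
    obtain t h c where t: "t \<ge> 0" and H: "(h, c) \<in> H" and hw: "h w \<noteq> 0"
      and e: "x + t *\<^sub>R w \<in> edge P h c"
      using polygon_ray_meets_edge[OF poly \<open>x \<in> P\<close> \<open>w \<noteq> 0\<close>] by blast
    have hi: "h (axis i 1) \<noteq> 0" using hw w linear_neg[OF lin[OF H]] by auto
    \<comment> \<open>Moving in direction \<open>i\<close> preserves the coordinate
      \<open>j\<close>, so the exit point is a \<open>line_point\<close> with parameter
      \<open>x$j\<close>.\<close>
    have xj: "(x + t *\<^sub>R w) $ j = x $ j" using w \<open>i \<noteq> j\<close> by (auto simp: axis_def)
    then have p: "line_point h c i j (x$j) = x + t *\<^sub>R w"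
      using line_point_unique[OF lin[OF H] \<open>i \<noteq> j\<close> hi, of "x + t *\<^sub>R w" c] e
      unfolding xj by (simp add: edge_def)
    have "f (x + t *\<^sub>R w) = (\<lambda>(h, c). ?F h c) (h, c)"
      using e edge_subset_frontier[OF poly H] by (auto simp: p)
    also have "\<dots> \<le> (\<Sum>(h, c) \<in> ?K. ?F h c)"
      by (rule member_le_sum[OF _ _ fK]) (use H hi F0 in auto)
    finally show ?thesis using t e by (auto simp: edge_def)
  qed
  obtain s t where "s \<ge> 0" "t \<ge> 0"
    and s: "x + s *\<^sub>R axis i 1 \<in> P" "f (x + s *\<^sub>R axis i 1) \<le> (\<Sum>(h, c) \<in> ?K. ?F h c)"
    and t: "x + t *\<^sub>R (- axis i 1) \<in> P" "f (x + t *\<^sub>R (- axis i 1)) \<le> (\<Sum>(h, c) \<in> ?K. ?F h c)"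
    using end_le by blast
  have "f x \<le> max (f (x + s *\<^sub>R axis i 1)) (f (x + t *\<^sub>R (- axis i 1)))"
    by (rule convex_on_le_max_ends[OF conv s(1) t(1)]) fact+
  then show ?thesis using s(2) t(2) by linarith
qed

section \<open>Integrals along edges against the boundary measure\<close>

text \<open>The boundary measure is a sum over edges, so it dominates the contribution of a single
  edge.\<close>

lemma nn_integral_edge_le_boundary:
  assumes poly: "polygon P H" and H: "(h, c) \<in> H" and F: "F \<in> borel_measurable borel"
    and g: "g \<in> borel_measurable borel" "\<And>t. h (g t) = c" "\<And>t. edge_form h (g t) = t"
      "\<And>x. h x = c \<Longrightarrow> g (edge_form h x) = x"
    and zero: "\<And>x. x \<notin> P \<Longrightarrow> F x = 0"
  shows "(\<integral>\<^sup>+t. F (g t) \<partial>lborel) \<le> (\<integral>\<^sup>+x. F x \<partial>boundary_measure P H)"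
proof -
  note [measurable] = F g(1)
  have "finite H" and "compact P" and lin: "linear h"
    using poly H by (auto simp: polygon_def primitive_map_def)
  have E [measurable]: "edge P h c \<in> sets borel"
  proof -
    have "closed {x. h x = c}"
      using linear_continuous_on[of h UNIV] lin
      by (intro closed_Collect_eq) (auto simp: linear_conv_bounded_linear)
    then show ?thesis unfolding edge_def
      by (intro borel_closed closed_Int compact_imp_closed[OF \<open>compact P\<close>])
  qed
  \<comment> \<open>The summand of this edge: Lebesgue measure carried to the line by
    \<open>g\<close> and restricted to the edge.\<close>
  define M where "M = density (distr lborel borel g) (indicator (edge P h c))"
  have sets_M: "sets M = sets borel" by (simp add: M_def)
  have "emeasure M A \<le> emeasure (boundary_measure P H) A" if A [measurable]: "A \<in> sets borel" for A
  proof -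
    have "emeasure M A = emeasure (distr lborel borel g) (A \<inter> edge P h c)"
      unfolding M_def using that E by (subst emeasure_restricted) (simp_all add: Int_commute)
    also have "\<dots> = emeasure lborel (g -` (A \<inter> edge P h c))"
      using that E g(1) by (subst emeasure_distr) simp_all
    also have "g -` (A \<inter> edge P h c) = edge_form h ` (A \<inter> edge P h c)"
      by (rule image_eq_vimage_inverse[symmetric]) (auto simp: g edge_def)
    also have "emeasure lborel (edge_form h ` (A \<inter> edge P h c)) \<le> emeasure (boundary_measure P H) A"
      unfolding emeasure_boundary_measure[OF poly A]
      using member_le_sum[OF H, of "\<lambda>(h, c). emeasure lborel (edge_form h ` (A \<inter> edge P h c))"] \<open>finite H\<close>
      by simp
    finally show ?thesis .
  qed
  then have "M \<le> boundary_measure P H"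
    by (subst le_measure) (simp_all add: sets_M)
  then have "(\<integral>\<^sup>+x. F x \<partial>M) \<le> (\<integral>\<^sup>+x. F x \<partial>boundary_measure P H)"
    by (intro nn_integral_mono_measure) (simp_all add: sets_M)
  moreover have "(\<integral>\<^sup>+x. F x \<partial>M) = (\<integral>\<^sup>+t. indicator (edge P h c) (g t) * F (g t) \<partial>lborel)"
    unfolding M_def by (simp add: nn_integral_density nn_integral_distr)
  \<comment> \<open>A point of the line outside the edge is outside \<open>P\<close>, where
    \<open>F\<close> vanishes.\<close>
  moreover have "indicator (edge P h c) (g t) * F (g t) = F (g t)" for t
    using zero[of "g t"] g(2) by (auto simp: edge_def indicator_def)
  ultimately show ?thesis by simp
qed

text \<open>On the line \<open>h x = c\<close> the edge form is an affine function of the coordinate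
  \<open>j\<close>. The wedge condition forces the absolute value of its slope to be
  \<open>1 / \<bar>h (axis i 1)\<bar>\<close>, whence the factor in the change of variables.\<close>

lemma nn_integral_line_point_le_boundary:
  assumes poly: "polygon P H" and H: "(h, c) \<in> H" and F: "F \<in> borel_measurable borel"
    and zero: "\<And>x. x \<notin> P \<Longrightarrow> F x = 0" and "i \<noteq> j" and hi: "h (axis i 1) \<noteq> 0"
  shows "(\<integral>\<^sup>+y. F (line_point h c i j y) \<partial>lborel)
    \<le> ennreal \<bar>h (axis i 1)\<bar> * (\<integral>\<^sup>+x. F x \<partial>boundary_measure P H)"
proof -
  have prim: "primitive_map h" using poly H by (auto simp: polygon_def)
  then have lin: "linear h" by (simp add: primitive_map_def)
  let ?s = "edge_form h" and ?p = "line_point h c i j"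
  have es: "is_edge_form h ?s" using prim by (rule edge_form)
  then have lins: "linear ?s" by (simp add: is_edge_form_def)
  obtain g where g: "g \<in> borel_measurable borel" "\<And>t. h (g t) = c" "\<And>t. ?s (g t) = t"
    "\<And>x. h x = c \<Longrightarrow> g (?s x) = x"
    using is_edge_form_inverse[OF lin es] by blast
  note [measurable] = F g(1)
  \<comment> \<open>Slope and constant term of \<open>?s (?p y)\<close> as a function of
    \<open>y\<close>.\<close>
  define m where "m = ?s (axis j 1) - h (axis j 1) / h (axis i 1) * ?s (axis i 1)"
  define d where "d = c / h (axis i 1) * ?s (axis i 1)"
  have sp: "?s (?p y) = d + m * y" for y
    using hi by (simp add: line_point_def linear_add[OF lins] linear_scale[OF lins] m_def d_def field_simps)
  have "\<bar>wedge h ?s (axis i 1) (axis j 1)\<bar> = 1"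
    using es exhaust_2[of i] exhaust_2[of j] \<open>i \<noteq> j\<close>
    by (auto simp: is_edge_form_def area_form_def axis_def)
  moreover have "h (axis i 1) * m = wedge h ?s (axis i 1) (axis j 1)"
    using hi by (simp add: m_def wedge_def field_simps)
  ultimately have hm: "\<bar>h (axis i 1)\<bar> * \<bar>m\<bar> = 1" by (simp add: abs_mult[symmetric])
  then have "m \<noteq> 0" by auto
  have gp: "g (d + m * y) = ?p y" for y
    using g(4)[OF line_point_on_line[OF lin hi, of c j y]] by (simp only: sp)
  have "(\<integral>\<^sup>+t. F (g t) \<partial>lborel) = ennreal \<bar>m\<bar> * (\<integral>\<^sup>+y. F (?p y) \<partial>lborel)"
    using nn_integral_real_affine[of "\<lambda>t. F (g t)" m d] \<open>m \<noteq> 0\<close> by (simp add: gp)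
  then have "ennreal \<bar>h (axis i 1)\<bar> * (\<integral>\<^sup>+t. F (g t) \<partial>lborel)
      = ennreal (\<bar>h (axis i 1)\<bar> * \<bar>m\<bar>) * (\<integral>\<^sup>+y. F (?p y) \<partial>lborel)"
    by (simp add: ennreal_mult mult.assoc)
  then have "(\<integral>\<^sup>+y. F (?p y) \<partial>lborel) = ennreal \<bar>h (axis i 1)\<bar> * (\<integral>\<^sup>+t. F (g t) \<partial>lborel)"
    by (simp add: hm)
  also have "\<dots> \<le> ennreal \<bar>h (axis i 1)\<bar> * (\<integral>\<^sup>+x. F x \<partial>boundary_measure P H)"
    by (intro mult_left_mono nn_integral_edge_le_boundary[OF poly H F g zero]) auto
  finally show ?thesis .
qed

section \<open>Integrability over the boundary\<close>

text \<open>Each of the finitely many summands measures a subset of a linear image of the compact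
  \<open>P\<close>, which is bounded.\<close>

lemma emeasure_boundary_measure_finite:
  assumes poly: "polygon P H" and A: "A \<in> sets borel"
  shows "emeasure (boundary_measure P H) A < \<infinity>"
proof -
  have "emeasure lborel (edge_form h ` (A \<inter> edge P h c)) < \<infinity>" if "(h, c) \<in> H" for h c
  proof -
    have "primitive_map h" "compact P" using poly that by (auto simp: polygon_def)
    then have "linear (edge_form h)"
      using edge_form by (auto simp: is_edge_form_def)
    then have "bounded (edge_form h ` P)"
      using \<open>compact P\<close> by (intro bounded_linear_image compact_imp_bounded) (auto simp: linear_conv_bounded_linear)
    then show ?thesis
      by (intro emeasure_bounded_finite bounded_subset[OF \<open>bounded _\<close>]) (auto simp: edge_def)
  qed
  moreover have "finite H" using poly by (simp add: polygon_def)
  ultimately show ?thesis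
    unfolding emeasure_boundary_measure[OF poly A] by (simp add: case_prod_beta)
qed

text \<open>A continuous function on the compact frontier is bounded, and the measure is finite.
  This ensures that the boundary integral is not the default value 0 of a non-integrable
  function.\<close>

lemma set_integrable_boundary_measure:
  fixes f :: "real^2 \<Rightarrow> real"
  assumes poly: "polygon P H" and cont: "continuous_on (frontier P) f"
  shows "set_integrable (boundary_measure P H) (frontier P) f"
proof -
  have "compact (frontier P)"
    using poly by (auto simp: polygon_def compact_frontier)
  then have "bounded (f ` frontier P)"
    using cont compact_continuous_image compact_imp_bounded by blast
  then obtain B where B: "\<And>x. x \<in> frontier P \<Longrightarrow> norm (f x) \<le> B"
    by (auto simp: bounded_iff)
  have fr: "frontier P \<in> sets borel"
    by (simp add: borel_closed)
  have "(\<lambda>x. indicator (frontier P) x *\<^sub>R f x) \<in> borel_measurable borel"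
    by (rule borel_measurable_continuous_on_indicator[OF fr cont])
  then show ?thesis
    unfolding set_integrable_def
    using fr B emeasure_boundary_measure_finite[OF poly fr]
    by (intro integrableI_bounded_set[where A = "frontier P" and B = B])
       (auto simp: measurable_cong_sets[OF sets_boundary_measure refl])
qed

section \<open>Separation of variables\<close>

text \<open>Bounding one factor of the square by each function of a single coordinate gives a
  product, whose integral factors by Tonelli.\<close>

lemma nn_integral_square_le:
  assumes meas: "\<And>j. G j \<in> borel_measurable borel"
    and le: "\<And>x :: real^2. F x \<le> G 1 (x$1)" "\<And>x. F x \<le> G 2 (x$2)"
  shows "(\<integral>\<^sup>+x. (F x)\<^sup>2 \<partial>lborel) \<le> (\<integral>\<^sup>+y. G 1 y \<partial>lborel) * (\<integral>\<^sup>+y. G 2 y \<partial>lborel)"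
proof -
  have B: "(Basis :: (real^2) set) = {axis 1 1, axis 2 1}"
    by (auto simp: Basis_vec_def UNIV_2)
  have ne: "axis 1 1 \<noteq> (axis 2 1 :: real^2)" by (simp add: axis_eq_axis)
  define g where "g b = G (if b = axis 1 1 then 1 else 2)" for b :: "real^2"
  have "(\<integral>\<^sup>+x. (F x)\<^sup>2 \<partial>lborel) \<le> (\<integral>\<^sup>+x. (\<Prod>b\<in>Basis. g b (x \<bullet> b)) \<partial>lborel)"
    using ne by (intro nn_integral_mono)
      (auto simp: B g_def inner_axis power2_eq_square intro!: mult_mono le)
  also have "\<dots> = (\<Prod>b\<in>Basis. \<integral>\<^sup>+y. g b y \<partial>lborel)"
    by (rule nn_integral_lborel_prod) (auto simp: g_def meas)
  also have "\<dots> = (\<integral>\<^sup>+y. G 1 y \<partial>lborel) * (\<integral>\<^sup>+y. G 2 y \<partial>lborel)"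
    using ne by (auto simp: B g_def)
  finally show ?thesis .
qed

section \<open>The estimate with an explicit constant\<close>

text \<open>The constant collects the scaling factors of all edges in both coordinates, so it serves
  for both chord directions and does not involve \<open>f\<close>.\<close>

lemma L2_norm_le_boundary_integral:
  assumes poly: "polygon P H" and cont: "continuous_on P f"
    and conv: "convex_on P f" and nn: "\<And>x. x \<in> P \<Longrightarrow> 0 \<le> f x"
  defines "C \<equiv> \<Sum>(h, c)\<in>H. \<bar>h (axis 1 1)\<bar> + \<bar>h (axis 2 1)\<bar>"
  shows "L2_norm P f \<le> C * (LINT x:frontier P|boundary_measure P H. f x)"
proof -
  let ?N = "boundary_measure P H"
  define I where "I = (LINT x:frontier P|?N. f x)"
  have "finite H" and "compact P"
    using poly by (auto simp: polygon_def)
  then have sub: "frontier P \<subseteq> P" by (simp add: frontier_subset_compact)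
  have fr: "frontier P \<in> sets borel" by (simp add: borel_closed)
  define F where "F x = ennreal (indicator (frontier P) x * f x)" for x
  have F_nn: "0 \<le> indicator (frontier P) x * f x" for x
    using nn sub by (auto simp: indicator_def)
  have F_meas [measurable]: "F \<in> borel_measurable borel"
    using borel_measurable_continuous_on_indicator[OF fr continuous_on_subset[OF cont sub]]
    unfolding F_def[abs_def] by simp
  have F_zero: "F x = 0" if "x \<notin> P" for x
    using that sub by (auto simp: F_def indicator_def)
  have "set_integrable ?N (frontier P) f"
    by (rule set_integrable_boundary_measure[OF poly continuous_on_subset[OF cont sub]])
  then have F_int: "(\<integral>\<^sup>+x. F x \<partial>?N) = ennreal I"
    unfolding F_def I_def set_lebesgue_integral_def set_integrable_def
    using F_nn by (subst nn_integral_eq_integral) auto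
  have "I \<ge> 0"
    unfolding I_def set_lebesgue_integral_def using F_nn by (intro integral_nonneg_AE) auto
  have "C \<ge> 0" unfolding C_def by (intro sum_nonneg) auto
  \<comment> \<open>\<open>K i\<close> keeps the lines transversal to direction \<open>i\<close>;
    \<open>G i j\<close> is the bound from chords in direction \<open>i\<close>, a function of the
    coordinate \<open>j\<close>.\<close>
  define K where "K i = {(h, c) \<in> H. h (axis i 1) \<noteq> 0}" for i :: 2
  define G where "G i j y = (\<Sum>(h, c) \<in> K i. F (line_point h c i j y))" for i j y
  have G_meas: "G i j \<in> borel_measurable borel" for i j
    unfolding G_def[abs_def] case_prod_beta by measurable
  have G_int: "(\<integral>\<^sup>+y. G i j y \<partial>lborel) \<le> ennreal (C * I)" if "i \<noteq> j" for i j
  proof -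
    have "(\<integral>\<^sup>+y. G i j y \<partial>lborel) = (\<Sum>(h, c) \<in> K i. \<integral>\<^sup>+y. F (line_point h c i j y) \<partial>lborel)"
      unfolding G_def case_prod_beta by (subst nn_integral_sum) auto
    also have "\<dots> \<le> (\<Sum>(h, c) \<in> K i. ennreal \<bar>h (axis i 1)\<bar> * ennreal I)"
      using nn_integral_line_point_le_boundary[OF poly _ F_meas F_zero that]
      by (intro sum_mono) (auto simp: K_def F_int)
    also have "\<dots> = ennreal ((\<Sum>(h, c) \<in> K i. \<bar>h (axis i 1)\<bar>) * I)"
      using \<open>I \<ge> 0\<close>
      by (simp add: case_prod_beta sum_distrib_right ennreal_mult sum_nonneg flip: sum_ennreal)
    also have "\<dots> \<le> ennreal (C * I)"
    proof -
      have "(\<Sum>(h, c) \<in> K i. \<bar>h (axis i 1)\<bar>) \<le> (\<Sum>(h, c) \<in> H. \<bar>h (axis i 1)\<bar>)"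
        using \<open>finite H\<close> by (intro sum_mono2) (auto simp: K_def)
      also have "\<dots> \<le> C"
        unfolding C_def using exhaust_2[of i] by (intro sum_mono) auto
      finally show ?thesis using \<open>I \<ge> 0\<close> by (intro ennreal_leI mult_right_mono)
    qed
    finally show ?thesis .
  qed
  have f_le: "ennreal (indicator P x * f x) \<le> G i j (x$j)" if "i \<noteq> j" for i j x
  proof (cases "x \<in> P")
    case True
    have "ennreal (f x) \<le> ennreal (\<Sum>(h, c) \<in> K i.
        indicator (frontier P) (line_point h c i j (x$j)) * f (line_point h c i j (x$j)))"
      unfolding K_def
      by (rule ennreal_leI[OF convex_le_sum_line_points[OF poly conv nn True that]])
    also have "\<dots> = G i j (x$j)"
      unfolding G_def F_def case_prod_beta using F_nn by (intro sum_ennreal[symmetric]) auto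
    finally show ?thesis using True by simp
  qed simp
  \<comment> \<open>Vertical chords give the factor in the first coordinate, horizontal chords the
    one in the second.\<close>
  have "(\<integral>\<^sup>+x. (ennreal (indicator P x * f x))\<^sup>2 \<partial>lborel)
      \<le> (\<integral>\<^sup>+y. G 2 1 y \<partial>lborel) * (\<integral>\<^sup>+y. G 1 2 y \<partial>lborel)"
    using nn_integral_square_le[of "\<lambda>j. G (if j = 1 then 2 else 1) j" "\<lambda>x. ennreal (indicator P x * f x)"]
      f_le G_meas by simp
  also have "\<dots> \<le> ennreal (C * I) * ennreal (C * I)"
    by (intro mult_mono G_int) auto
  also have "\<dots> = ennreal ((C * I)\<^sup>2)"
    using \<open>C \<ge> 0\<close> \<open>I \<ge> 0\<close> by (simp add: ennreal_mult power2_eq_square)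
  finally have "(\<integral>\<^sup>+x. (ennreal (indicator P x * f x))\<^sup>2 \<partial>lborel) \<le> ennreal ((C * I)\<^sup>2)" .
  moreover have "ennreal (indicator P x *\<^sub>R \<bar>f x\<bar>\<^sup>2) = (ennreal (indicator P x * f x))\<^sup>2" for x
    using nn[of x] by (cases "x \<in> P") (auto simp: ennreal_power)
  ultimately have "(LINT x:P|lborel. \<bar>f x\<bar>\<^sup>2) \<le> (C * I)\<^sup>2"
    unfolding set_lebesgue_integral_def by (intro integral_real_bounded) simp_all
  then have "L2_norm P f \<le> sqrt ((C * I)\<^sup>2)"
    unfolding L2_norm_def by (rule real_sqrt_le_mono)
  also have "\<dots> = C * I" using \<open>C \<ge> 0\<close> \<open>I \<ge> 0\<close> by simp
  finally show ?thesis by (simp add: I_def)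
qed

theorem proposition4p2p2:
  fixes P :: "(real^2) set" and H :: "((real^2 \<Rightarrow> real) \<times> real) set"
  assumes "polygon P H"
  shows "\<exists>C::real. \<forall>f::real^2 \<Rightarrow> real.
    continuous_on P f \<and> convex_on P f \<and> (\<forall>x\<in>P. 0 \<le> f x) \<longrightarrow>
    L2_norm P f \<le> C * (LINT x:frontier P|boundary_measure P H. f x)"
  using L2_norm_le_boundary_integral[OF assms] by blast

end
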